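(* Let $\alpha\in\mathbb R$, set $s_1=-\infty$ and set $s_m=1+\frac{\log(1-1/m)}{\log(1+1/m)}$ for $m=2,3,\dots$. The inequality \[ \sup_{n\ge1}\Big|\Big(\frac1n\sum_{k=1}^nx_k\Big)-x_n\Big|n^\alpha\le A\sup_{k\ge1}|x_k|k^\alpha \] holds for all real sequences $x$ with best (least) constant \[ A=\begin{cases}\dfrac{2-\alpha}{1-\alpha},&\alpha<1;\\\infty,&\alpha\ge1.\end{cases} \] It holds for all nonnegative sequences $x$ with best constant \[ A=\begin{cases}1,&\alpha<0;\\ \dfrac1{1-\alpha},&0\le\alpha<1;\\ \infty,&\alpha\ge1.\end{cases} \] It holds for all nonnegative, nonincreasing sequences $x$ with best constant \[ A=\begin{cases}(m+1)^{\alpha-1}m,&s_m<\alpha\le s_{m+1},\ m=1,2,3,\dots;\\ \dfrac1{1-\alpha},&0\le\alpha<1;\\ \infty,&\alpha\ge1.\end{cases} \] It holds for all nonnegative, nondecreasing sequences $x$ with best constant \[ A=\begin{cases}1,&\alpha\le0;\\ 0,&\alpha>0.\end{cases} \]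
   Context: Sequences are indexed by the positive integers; suprema take values in $[0,\infty]$, and best constant means the least $A\in[0,\infty]$ for which the inequality holds for all the sequences indicated. Conventions: $\infty\cdot0=0$ when $A=\infty$ and the supremum on the right is $0$; the inequality is regarded as holding whenever the supremum on the right-hand side is $\infty$ (even if $A=0$). *)

theory Defs
  imports "HOL-Analysis.Analysis"
begin

text \<open>
  A sequence indexed by the positive integers is a function \<open>nat \<Rightarrow> real\<close> of which only the
  values at indices \<open>\<ge> 1\<close> matter; every condition below is restricted to \<open>{1..}\<close>.
\<close>

definition lhs_sup :: "real \<Rightarrow> (nat \<Rightarrow> real) \<Rightarrow> ennreal" where
  "lhs_sup \<alpha> x =
     (SUP n\<in>{1..}. ennreal (\<bar>1 / real n * (\<Sum>k=1..n. x k) - x n\<bar> * real n powr \<alpha>))"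

definition rhs_sup :: "real \<Rightarrow> (nat \<Rightarrow> real) \<Rightarrow> ennreal" where
  "rhs_sup \<alpha> x = (SUP k\<in>{1..}. ennreal (\<bar>x k\<bar> * real k powr \<alpha>))"

text \<open>
  In \<^typ>\<open>ennreal\<close> both \<open>\<infinity> * 0\<close> and \<open>0 * \<infinity>\<close> are \<open>0\<close>. The first is the intended convention; the
  first disjunct is needed for \<open>A = 0\<close>, since the inequality is regarded as holding whenever the
  supremum on the right is infinite.
\<close>

definition ineq_holds :: "real \<Rightarrow> ennreal \<Rightarrow> (nat \<Rightarrow> real) \<Rightarrow> bool" where
  "ineq_holds \<alpha> A x \<longleftrightarrow> rhs_sup \<alpha> x = \<infinity> \<or> lhs_sup \<alpha> x \<le> A * rhs_sup \<alpha> x"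

definition best_constant :: "real \<Rightarrow> (nat \<Rightarrow> real) set \<Rightarrow> ennreal \<Rightarrow> bool" where
  "best_constant \<alpha> S A \<longleftrightarrow>
     (\<forall>x\<in>S. ineq_holds \<alpha> A x) \<and> (\<forall>B. (\<forall>x\<in>S. ineq_holds \<alpha> B x) \<longrightarrow> A \<le> B)"

definition nonneg_seqs :: "(nat \<Rightarrow> real) set" where
  "nonneg_seqs = {x. \<forall>k\<ge>1. 0 \<le> x k}"

definition nonincreasing_seqs :: "(nat \<Rightarrow> real) set" where
  "nonincreasing_seqs = {x. antimono_on {1..} x}"

definition nondecreasing_seqs :: "(nat \<Rightarrow> real) set" where
  "nondecreasing_seqs = {x. mono_on {1..} x}"

text \<open>Only the values at \<open>m \<ge> 1\<close> are meaningful.\<close>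

definition s :: "nat \<Rightarrow> ereal" where
  "s m = (if m \<le> 1 then -\<infinity>
          else ereal (1 + ln (1 - 1 / real m) / ln (1 + 1 / real m)))"

end

theory Submission
  imports Defs "HOL-Real_Asymp.Real_Asymp"
begin

text \<open>
  Call \<open>1/n * (\<Sum>k=1..n. x k) - x n\<close> the defect of \<open>x\<close> at \<open>n\<close>. Splitting off the last term of the
  sum turns it into \<open>(\<Sum>k=1..<n. x k) / n - (1 - 1/n) * x n\<close>: an average of the past, weighted
  positively, against the present, weighted negatively. Normalise to \<open>\<bar>x k\<bar> * k\<^sup>\<alpha> \<le> 1\<close>. In each
  class the largest possible value of the absolute defect times \<open>n\<^sup>\<alpha>\<close> can then be read off at a
  fixed \<open>n\<close>, and the best constant is its supremum over \<open>n\<close>.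

  For arbitrary and for nonnegative sequences the two parts are extremised independently. The past
  contributes at most \<open>n powr (\<alpha> - 1) * (\<Sum>k=1..<n. k powr -\<alpha>)\<close> and the present at most
  \<open>1 - 1/n\<close>; signed sequences can add the two, nonnegative ones can only realise the larger. For \<open>\<alpha> < 1\<close> comparison
  of the sum with the integral of \<open>t powr -\<alpha>\<close> bounds the first quantity by \<open>1 / (1 - \<alpha>)\<close> and shows that
  it tends to this bound (\<open>power_sum_le\<close>, \<open>power_sum_ge\<close>). For \<open>\<alpha> \<ge> 1\<close> it dominates the harmonic
  numbers, so that no finite constant is possible.

  For nonnegative, nonincreasing sequences and \<open>\<alpha> \<ge> 0\<close> the extremal sequences of the nonnegative
  case, \<open>k powr -\<alpha>\<close> cut off at \<open>n\<close>, are still admissible. If \<open>\<alpha> < 0\<close>, then \<open>k\<^sup>\<alpha> \<le> 1\<close> and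
  \<open>x k \<le> x 1\<close>, so the normalisation only says \<open>x 1 \<le> 1\<close>; the extremal sequences are steps
  \<open>1, ..., 1, 0, 0, ...\<close>, and the best constant is the maximum over \<open>m\<close> of
  \<open>m * (m + 1) powr (\<alpha> - 1)\<close>. As a function of a real variable \<open>u\<close>, the logarithm of
  \<open>u * (u + 1) powr (\<alpha> - 1)\<close> has a derivative with the sign of \<open>\<alpha> * u + 1\<close>, so it first increases
  and then decreases, whence a local maximum is global (\<open>step_defect_le_peak\<close>). The thresholds
  \<open>s m\<close> with \<open>m \<ge> 2\<close> are exactly the values of \<open>\<alpha>\<close> at which the terms with indices \<open>m - 1\<close> and \<open>m\<close>
  are equal (\<open>s_less_iff\<close>), so they tell where that local maximum is.

  For nonnegative, nondecreasing sequences the present outweighs the past, which can only bring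
  the defect closer to \<open>0\<close>. Jumps from \<open>0\<close> to a constant show that the
  constant \<open>1\<close> is best if \<open>\<alpha> \<le> 0\<close>, and if \<open>\<alpha> > 0\<close> the right-hand side is finite only for the zero
  sequence.
\<close>

section \<open>Reduction to estimates for normalised sequences\<close>

definition defect :: "(nat \<Rightarrow> real) \<Rightarrow> nat \<Rightarrow> real" where
  "defect x n = 1 / real n * (\<Sum>k=1..n. x k) - x n"

lemma lhs_sup_defect: "lhs_sup \<alpha> x = (SUP n\<in>{1..}. ennreal (\<bar>defect x n\<bar> * real n powr \<alpha>))"
  by (simp add: lhs_sup_def defect_def)

lemma defect_split:
  assumes "1 \<le> n"
  shows "defect x n = (\<Sum>k\<in>{1..<n}. x k) / real n - (1 - 1 / real n) * x n"
proof -
  have "{1..n} = insert n {1..<n}"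
    using assms by auto
  then have "(\<Sum>k=1..n. x k) = x n + (\<Sum>k\<in>{1..<n}. x k)"
    by simp
  then show ?thesis
    using assms by (simp add: defect_def field_simps)
qed

lemma ineq_holdsI:
  assumes "0 \<le> C"
    and "\<And>M n. \<lbrakk>0 \<le> M; \<And>k. 1 \<le> k \<Longrightarrow> \<bar>x k\<bar> * real k powr \<alpha> \<le> M; 1 \<le> n\<rbrakk>
           \<Longrightarrow> \<bar>defect x n\<bar> * real n powr \<alpha> \<le> C * M"
  shows "ineq_holds \<alpha> (ennreal C) x"
proof (cases "rhs_sup \<alpha> x")
  case top
  then show ?thesis by (simp add: ineq_holds_def)
next
  case (real M)
  have bound: "\<bar>x k\<bar> * real k powr \<alpha> \<le> M" if "1 \<le> k" for k
  proof -
    have "ennreal (\<bar>x k\<bar> * real k powr \<alpha>) \<le> ennreal M"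
      unfolding real(2)[symmetric] rhs_sup_def by (rule SUP_upper) (use that in auto)
    then show ?thesis
      using real(1) by simp
  qed
  have "lhs_sup \<alpha> x \<le> ennreal (C * M)"
    unfolding lhs_sup_defect
    by (rule SUP_least) (auto intro!: ennreal_leI assms(2)[OF real(1) bound])
  then show ?thesis
    using assms(1) real by (simp add: ineq_holds_def ennreal_mult)
qed

text \<open>
  The only sequences for which \<open>\<infinity>\<close> times the right-hand side is not infinite have all
  terms zero, and then the left-hand side vanishes too.
\<close>

lemma ineq_holds_infinity: "ineq_holds \<alpha> \<infinity> x"
proof (cases "rhs_sup \<alpha> x = 0")
  case True
  have "x k = 0" if "1 \<le> k" for k
  proof -
    have "ennreal (\<bar>x k\<bar> * real k powr \<alpha>) \<le> 0"
      unfolding True[symmetric] rhs_sup_def by (rule SUP_upper) (use that in auto)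
    then have "\<bar>x k\<bar> * real k powr \<alpha> \<le> 0"
      by (simp add: ennreal_eq_0_iff)
    then show ?thesis
      using that by (auto simp: mult_le_0_iff)
  qed
  then have "lhs_sup \<alpha> x \<le> 0"
    unfolding lhs_sup_defect by (intro SUP_least) (auto simp: defect_def)
  then show ?thesis
    by (simp add: ineq_holds_def)
next
  case False
  then show ?thesis
    by (simp add: ineq_holds_def ennreal_top_mult)
qed

lemma defect_le_constant:
  assumes "ineq_holds \<alpha> B x" "\<And>k. 1 \<le> k \<Longrightarrow> \<bar>x k\<bar> * real k powr \<alpha> \<le> 1" "1 \<le> n"
  shows "ennreal (\<bar>defect x n\<bar> * real n powr \<alpha>) \<le> B"
proof -
  have "rhs_sup \<alpha> x \<le> 1"
    unfolding rhs_sup_def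
    by (rule SUP_least) (use assms(2) in \<open>auto simp: ennreal_le_1\<close>)
  then have "lhs_sup \<alpha> x \<le> B * rhs_sup \<alpha> x" "B * rhs_sup \<alpha> x \<le> B"
    using assms(1) mult_left_mono[of "rhs_sup \<alpha> x" 1 B]
    by (auto simp: ineq_holds_def top_unique)
  moreover have "ennreal (\<bar>defect x n\<bar> * real n powr \<alpha>) \<le> lhs_sup \<alpha> x"
    unfolding lhs_sup_defect by (rule SUP_upper) (use assms(3) in auto)
  ultimately show ?thesis
    by order
qed

text \<open>
  Optimality is always shown in the same way: the \<open>n\<close>-th test sequence is normalised and built to
  have a large defect at the index \<open>n\<close>, and the defects tend to the constant.
\<close>

lemma best_constantI:
  assumes holds: "\<And>x. x \<in> S \<Longrightarrow> ineq_holds \<alpha> A x"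
    and test: "\<And>n. 1 \<le> n \<Longrightarrow> y n \<in> S"
    and normalised: "\<And>n k. \<lbrakk>1 \<le> n; 1 \<le> k\<rbrakk> \<Longrightarrow> \<bar>y n k\<bar> * real k powr \<alpha> \<le> 1"
    and large: "\<And>n. 1 \<le> n \<Longrightarrow> c n \<le> \<bar>defect (y n) n\<bar> * real n powr \<alpha>"
    and lim: "(\<lambda>n. ennreal (c n)) \<longlonglongrightarrow> A"
  shows "best_constant \<alpha> S A"
  unfolding best_constant_def
proof (intro conjI ballI allI impI)
  fix B assume B: "\<forall>x\<in>S. ineq_holds \<alpha> B x"
  have "ennreal (c n) \<le> B" if "1 \<le> n" for n
  proof -
    have "ennreal (c n) \<le> ennreal (\<bar>defect (y n) n\<bar> * real n powr \<alpha>)"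
      using large[OF that] by (rule ennreal_leI)
    also have "\<dots> \<le> B"
      using B test[OF that] normalised[OF that] that by (intro defect_le_constant) auto
    finally show ?thesis .
  qed
  then show "A \<le> B"
    using lim by (intro LIMSEQ_le_const2) auto
qed (rule holds)


section \<open>Comparing power sums with integrals\<close>

lemma powr_increment:
  fixes a p :: real
  assumes "0 \<le> a" "0 < p"
  obtains \<xi> where "a < \<xi>" "\<xi> < a + 1" "(a + 1) powr p - a powr p = p * \<xi> powr (p - 1)"
proof -
  have "\<exists>l z. a < z \<and> z < a + 1 \<and> ((\<lambda>t. t powr p) has_real_derivative l) (at z) \<and>
        (a + 1) powr p - a powr p = (a + 1 - a) * l"
  proof (rule MVT)
    show "continuous_on {a..a + 1} (\<lambda>t. t powr p)"
      using assms by (intro continuous_on_powr') (auto intro!: continuous_intros)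
    show "(\<lambda>t. t powr p) differentiable (at z)" if "a < z" for z
      using that assms has_real_derivative_powr[of z p] by (auto simp: real_differentiable_def)
  qed simp
  then obtain l z where z: "a < z" "z < a + 1" "((\<lambda>t. t powr p) has_real_derivative l) (at z)"
    "(a + 1) powr p - a powr p = l"
    by auto
  have "l = p * z powr (p - 1)"
    using z(1,3) assms by (intro DERIV_unique[OF z(3)] has_real_derivative_powr) auto
  with z that show thesis
    by blast
qed

text \<open>
  The sum stops before \<open>n\<close>, which leaves room for a bound without error term whether \<open>t powr -\<alpha>\<close> is
  increasing (compare with the integral over \<open>{1..n}\<close>) or decreasing (over \<open>{0..n-1}\<close>).
\<close>

lemma power_sum_le:
  assumes "\<alpha> < 1" "1 \<le> n"
  shows "(\<Sum>k\<in>{1..<n}. real k powr -\<alpha>) \<le> real n powr (1 - \<alpha>) / (1 - \<alpha>)"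
proof (cases "\<alpha> \<le> 0")
  case True
  show ?thesis
    using assms(2)
  proof (induction n rule: dec_induct)
    case (step n)
    obtain \<xi> where \<xi>: "real n < \<xi>"
      "(real n + 1) powr (1 - \<alpha>) - real n powr (1 - \<alpha>) = (1 - \<alpha>) * \<xi> powr (1 - \<alpha> - 1)"
      by (rule powr_increment[of "real n" "1 - \<alpha>"]) (use assms in auto)
    have "real n powr -\<alpha> \<le> \<xi> powr -\<alpha>"
      using \<xi>(1) True by (intro powr_mono2) auto
    also have "\<dots> = ((real n + 1) powr (1 - \<alpha>) - real n powr (1 - \<alpha>)) / (1 - \<alpha>)"
      using \<xi>(2) assms by simp
    finally show ?case
      using step by (simp add: diff_divide_distrib add.commute)
  qed (use assms in simp)
next
  case False
  have "(\<Sum>k\<in>{1..<n}. real k powr -\<alpha>) \<le> (real n - 1) powr (1 - \<alpha>) / (1 - \<alpha>)"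
    using assms(2)
  proof (induction n rule: dec_induct)
    case (step n)
    obtain \<xi> where \<xi>: "real n - 1 < \<xi>" "\<xi> < real n - 1 + 1"
      "(real n - 1 + 1) powr (1 - \<alpha>) - (real n - 1) powr (1 - \<alpha>) = (1 - \<alpha>) * \<xi> powr (1 - \<alpha> - 1)"
      by (rule powr_increment[of "real n - 1" "1 - \<alpha>"]) (use assms step in auto)
    have "real n powr -\<alpha> \<le> \<xi> powr -\<alpha>"
      using \<xi>(1,2) False step by (intro powr_mono2') auto
    also have "\<dots> = (real n powr (1 - \<alpha>) - (real n - 1) powr (1 - \<alpha>)) / (1 - \<alpha>)"
      using \<xi>(3) assms by simp
    finally show ?case
      using step by (simp add: diff_divide_distrib)
  qed simp
  also have "\<dots> \<le> real n powr (1 - \<alpha>) / (1 - \<alpha>)"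
    using assms by (intro divide_right_mono powr_mono2) auto
  finally show ?thesis .
qed

text \<open>
  Comparison with integrals gives the lower bound \<open>(n - 1) powr (1 - \<alpha>)\<close> for \<open>\<alpha> \<le> 0\<close> and
  \<open>n powr (1 - \<alpha>) - 1\<close> for \<open>\<alpha> \<ge> 0\<close>, up to the factor \<open>1 - \<alpha>\<close>; the bound stated is weaker than
  both and has the right leading term.
\<close>

lemma power_sum_ge:
  assumes "\<alpha> < 1" "1 \<le> n"
  shows "((real n - 1) powr (1 - \<alpha>) - 1) / (1 - \<alpha>) \<le> (\<Sum>k\<in>{1..<n}. real k powr -\<alpha>)"
proof (cases "\<alpha> \<le> 0")
  case True
  have "((real n - 1) powr (1 - \<alpha>) - 1) / (1 - \<alpha>) \<le> (real n - 1) powr (1 - \<alpha>) / (1 - \<alpha>)"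
    using assms by (intro divide_right_mono) auto
  also have "\<dots> \<le> (\<Sum>k\<in>{1..<n}. real k powr -\<alpha>)"
    using assms(2)
  proof (induction n rule: dec_induct)
    case (step n)
    obtain \<xi> where \<xi>: "real n - 1 < \<xi>" "\<xi> < real n - 1 + 1"
      "(real n - 1 + 1) powr (1 - \<alpha>) - (real n - 1) powr (1 - \<alpha>) = (1 - \<alpha>) * \<xi> powr (1 - \<alpha> - 1)"
      by (rule powr_increment[of "real n - 1" "1 - \<alpha>"]) (use assms step in auto)
    have "(real n powr (1 - \<alpha>) - (real n - 1) powr (1 - \<alpha>)) / (1 - \<alpha>) = \<xi> powr -\<alpha>"
      using \<xi>(3) assms by simp
    also have "\<dots> \<le> real n powr -\<alpha>"
      using \<xi>(1,2) True step by (intro powr_mono2) auto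
    finally show ?case
      using step by (simp add: diff_divide_distrib)
  qed simp
  finally show ?thesis .
next
  case False
  have "((real n - 1) powr (1 - \<alpha>) - 1) / (1 - \<alpha>) \<le> (real n powr (1 - \<alpha>) - 1) / (1 - \<alpha>)"
    using assms by (intro divide_right_mono diff_right_mono powr_mono2) auto
  also have "\<dots> \<le> (\<Sum>k\<in>{1..<n}. real k powr -\<alpha>)"
    using assms(2)
  proof (induction n rule: dec_induct)
    case (step n)
    obtain \<xi> where \<xi>: "real n < \<xi>"
      "(real n + 1) powr (1 - \<alpha>) - real n powr (1 - \<alpha>) = (1 - \<alpha>) * \<xi> powr (1 - \<alpha> - 1)"
      by (rule powr_increment[of "real n" "1 - \<alpha>"]) (use assms in auto)
    have "((real n + 1) powr (1 - \<alpha>) - real n powr (1 - \<alpha>)) / (1 - \<alpha>) = \<xi> powr -\<alpha>"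
      using \<xi>(2) assms by simp
    also have "\<dots> \<le> real n powr -\<alpha>"
      using \<xi>(1) False step by (intro powr_mono2') auto
    finally show ?case
      using step by (simp add: diff_divide_distrib add.commute)
  qed simp
  finally show ?thesis .
qed

definition weighted_past :: "real \<Rightarrow> nat \<Rightarrow> real" where
  "weighted_past \<alpha> n = (\<Sum>k\<in>{1..<n}. real k powr -\<alpha>) / real n * real n powr \<alpha>"

lemma weighted_past_nonneg: "0 \<le> weighted_past \<alpha> n"
  by (auto simp: weighted_past_def intro!: sum_nonneg divide_nonneg_nonneg mult_nonneg_nonneg)

lemma weighted_past_le:
  assumes "\<alpha> < 1" "1 \<le> n"
  shows "weighted_past \<alpha> n \<le> 1 / (1 - \<alpha>)"
proof -
  have "weighted_past \<alpha> n \<le> real n powr (1 - \<alpha>) / (1 - \<alpha>) / real n * real n powr \<alpha>"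
    unfolding weighted_past_def
    by (intro mult_right_mono divide_right_mono power_sum_le assms) auto
  also have "\<dots> = 1 / (1 - \<alpha>)"
    using assms by (simp add: powr_diff)
  finally show ?thesis .
qed

text \<open>A lower bound for \<open>weighted_past \<alpha> n\<close> with the same limit \<open>1 / (1 - \<alpha>)\<close> if \<open>\<alpha> < 1\<close>.\<close>

definition past_minorant :: "real \<Rightarrow> nat \<Rightarrow> real" where
  "past_minorant \<alpha> n = ((real n - 1) powr (1 - \<alpha>) - 1) / (1 - \<alpha>) / real n * real n powr \<alpha>"

lemma past_minorant_le: "\<lbrakk>\<alpha> < 1; 1 \<le> n\<rbrakk> \<Longrightarrow> past_minorant \<alpha> n \<le> weighted_past \<alpha> n"
  unfolding weighted_past_def past_minorant_def
  by (intro mult_right_mono divide_right_mono power_sum_ge) auto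

lemma past_minorant_tendsto:
  assumes "\<alpha> < 1"
  shows "past_minorant \<alpha> \<longlonglongrightarrow> 1 / (1 - \<alpha>)"
proof -
  have "(\<lambda>n. ((1 - 1 / real n) powr (1 - \<alpha>) - real n powr (\<alpha> - 1)) / (1 - \<alpha>))
          \<longlonglongrightarrow> (1 powr (1 - \<alpha>) - 0) / (1 - \<alpha>)"
  proof (intro tendsto_intros)
    show "(\<lambda>n. 1 - 1 / real n) \<longlonglongrightarrow> 1"
      by real_asymp
    show "(\<lambda>n. real n powr (\<alpha> - 1)) \<longlonglongrightarrow> 0"
      using assms by (intro tendsto_neg_powr filterlim_real_sequentially) auto
  qed (use assms in auto)
  moreover have "\<forall>\<^sub>F n in sequentially.
      ((1 - 1 / real n) powr (1 - \<alpha>) - real n powr (\<alpha> - 1)) / (1 - \<alpha>) = past_minorant \<alpha> n"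
    using eventually_ge_at_top[of 1]
  proof eventually_elim
    case (elim n)
    have "1 - 1 / real n = (real n - 1) / real n"
      using elim by (simp add: field_simps)
    then have "(1 - 1 / real n) powr (1 - \<alpha>) = (real n - 1) powr (1 - \<alpha>) / real n powr (1 - \<alpha>)"
      using elim by (simp add: powr_divide)
    moreover have "real n powr (1 - \<alpha>) = real n / real n powr \<alpha>"
      "real n powr (\<alpha> - 1) = real n powr \<alpha> / real n"
      using elim by (simp_all add: powr_diff)
    ultimately have eq: "(1 - 1 / real n) powr (1 - \<alpha>) = (real n - 1) powr (1 - \<alpha>) * real n powr \<alpha> / real n"
      "real n powr (\<alpha> - 1) = real n powr \<alpha> / real n"
      by simp_all
    have arith: "(a * b / c - b / c) / d = (a - 1) / d / c * b" for a b c d :: real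
      by (simp add: diff_divide_distrib algebra_simps)
    show ?case
      unfolding past_minorant_def eq by (rule arith)
  qed
  ultimately show ?thesis
    by (simp add: filterlim_cong)
qed

lemma ln_le_weighted_past:
  assumes "1 \<le> \<alpha>" "1 \<le> n"
  shows "ln (real n) \<le> weighted_past \<alpha> n"
proof -
  have "ln (real n) \<le> (\<Sum>k\<in>{1..<n}. 1 / real k)"
    using assms(2)
  proof (induction n rule: dec_induct)
    case (step n)
    have "ln (real (Suc n)) - ln (real n) = ln (real (Suc n) / real n)"
      by (subst ln_div) (use step in auto)
    also have "real (Suc n) / real n = 1 + 1 / real n"
      using step by (simp add: field_simps)
    also have "ln (1 + 1 / real n) \<le> 1 / real n"
      by (rule ln_add_one_self_le_self) simp
    finally show ?case
      using step by simp
  qed simp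
  also have "\<dots> \<le> (\<Sum>k\<in>{1..<n}. real k powr -\<alpha> / real n * real n powr \<alpha>)"
  proof (rule sum_mono)
    fix k assume k: "k \<in> {1..<n}"
    have "real k powr (\<alpha> - 1) \<le> real n powr (\<alpha> - 1)"
      using k assms by (intro powr_mono2) auto
    then show "1 / real k \<le> real k powr -\<alpha> / real n * real n powr \<alpha>"
      using k by (simp add: powr_diff powr_minus field_simps)
  qed
  also have "\<dots> = weighted_past \<alpha> n"
    by (simp add: weighted_past_def sum_distrib_right sum_divide_distrib)
  finally show ?thesis .
qed

lemma past_term_le:
  assumes "\<And>k. 1 \<le> k \<Longrightarrow> \<bar>x k\<bar> * real k powr \<alpha> \<le> M"
  shows "(\<Sum>k\<in>{1..<n}. \<bar>x k\<bar>) / real n * real n powr \<alpha> \<le> M * weighted_past \<alpha> n"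
proof -
  have "(\<Sum>k\<in>{1..<n}. \<bar>x k\<bar>) \<le> (\<Sum>k\<in>{1..<n}. M * real k powr -\<alpha>)"
  proof (rule sum_mono)
    fix k assume "k \<in> {1..<n}"
    then show "\<bar>x k\<bar> \<le> M * real k powr -\<alpha>"
      using assms[of k] by (simp add: powr_minus field_simps)
  qed
  then have "(\<Sum>k\<in>{1..<n}. \<bar>x k\<bar>) / real n * real n powr \<alpha>
               \<le> (\<Sum>k\<in>{1..<n}. M * real k powr -\<alpha>) / real n * real n powr \<alpha>"
    by (intro mult_right_mono divide_right_mono) auto
  then show ?thesis
    by (simp add: weighted_past_def sum_distrib_left[symmetric] mult.assoc)
qed

lemma present_term_le:
  assumes "\<bar>x n\<bar> * real n powr \<alpha> \<le> M" "1 \<le> n"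
  shows "(1 - 1 / real n) * \<bar>x n\<bar> * real n powr \<alpha> \<le> M"
proof -
  have "(1 - 1 / real n) * (\<bar>x n\<bar> * real n powr \<alpha>) \<le> 1 * (\<bar>x n\<bar> * real n powr \<alpha>)"
    by (intro mult_right_mono) auto
  then show ?thesis
    using assms(1) by (simp add: mult.assoc)
qed


section \<open>Arbitrary and nonnegative sequences\<close>

definition truncated_power :: "real \<Rightarrow> nat \<Rightarrow> nat \<Rightarrow> real" where
  "truncated_power \<alpha> n k = (if k < n then real k powr -\<alpha> else 0)"

lemma truncated_power_normalised:
  "1 \<le> k \<Longrightarrow> \<bar>truncated_power \<alpha> n k\<bar> * real k powr \<alpha> \<le> 1"
  by (simp add: truncated_power_def powr_minus)

lemma defect_truncated_power:
  assumes "1 \<le> n"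
  shows "\<bar>defect (truncated_power \<alpha> n) n\<bar> * real n powr \<alpha> = weighted_past \<alpha> n"
proof -
  have "(\<Sum>k\<in>{1..<n}. truncated_power \<alpha> n k) = (\<Sum>k\<in>{1..<n}. real k powr -\<alpha>)"
    by (rule sum.cong) (auto simp: truncated_power_def)
  moreover have "truncated_power \<alpha> n n = 0"
    by (simp add: truncated_power_def)
  ultimately have "defect (truncated_power \<alpha> n) n = (\<Sum>k\<in>{1..<n}. real k powr -\<alpha>) / real n"
    using assms by (simp add: defect_split)
  then show ?thesis
    by (simp add: weighted_past_def sum_nonneg)
qed

lemma best_constant_infinity:
  assumes "1 \<le> \<alpha>" "\<And>n. truncated_power \<alpha> n \<in> S"
  shows "best_constant \<alpha> S \<infinity>"
proof (rule best_constantI[where y = "truncated_power \<alpha>" and c = "\<lambda>n. ln (real n)"])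
  show "ln (real n) \<le> \<bar>defect (truncated_power \<alpha> n) n\<bar> * real n powr \<alpha>" if "1 \<le> n" for n
    using ln_le_weighted_past[OF assms(1) that] defect_truncated_power[OF that] by simp
  have "filterlim (\<lambda>n. ln (real n)) at_top sequentially"
    by real_asymp
  then show "(\<lambda>n. ennreal (ln (real n))) \<longlonglongrightarrow> \<infinity>"
    by (simp add: ennreal_tendsto_top_eq_at_top)
qed (use assms in \<open>auto intro: truncated_power_normalised ineq_holds_infinity[unfolded infinity_ennreal_def]\<close>)

lemma best_constant_all:
  assumes "\<alpha> < 1"
  shows "best_constant \<alpha> UNIV (ennreal ((2 - \<alpha>) / (1 - \<alpha>)))"
proof -
  have split_const: "(2 - \<alpha>) / (1 - \<alpha>) = 1 / (1 - \<alpha>) + 1"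
    using assms by (simp add: field_simps)
  \<comment> \<open>The sign change at \<open>n\<close> makes past and present pull in the same direction.\<close>
  define y where "y n = (truncated_power \<alpha> n)(n := - (real n powr -\<alpha>))" for n
  show ?thesis
  proof (rule best_constantI[where y = y and c = "\<lambda>n. past_minorant \<alpha> n + (1 - 1 / real n)"])
    fix x :: "nat \<Rightarrow> real"
    show "ineq_holds \<alpha> (ennreal ((2 - \<alpha>) / (1 - \<alpha>))) x"
    proof (rule ineq_holdsI)
      fix M :: real and n :: nat
      assume M: "0 \<le> M" "\<And>k. 1 \<le> k \<Longrightarrow> \<bar>x k\<bar> * real k powr \<alpha> \<le> M" and n: "1 \<le> n"
      have "\<bar>(\<Sum>k\<in>{1..<n}. x k) / real n\<bar> \<le> (\<Sum>k\<in>{1..<n}. \<bar>x k\<bar>) / real n"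
        by (simp add: divide_right_mono sum_abs)
      moreover have "\<bar>(1 - 1 / real n) * x n\<bar> = (1 - 1 / real n) * \<bar>x n\<bar>"
        using n by (simp add: abs_mult)
      ultimately have "\<bar>defect x n\<bar> \<le> (\<Sum>k\<in>{1..<n}. \<bar>x k\<bar>) / real n + (1 - 1 / real n) * \<bar>x n\<bar>"
        unfolding defect_split[OF n] by linarith
      then have "\<bar>defect x n\<bar> * real n powr \<alpha>
          \<le> ((\<Sum>k\<in>{1..<n}. \<bar>x k\<bar>) / real n + (1 - 1 / real n) * \<bar>x n\<bar>) * real n powr \<alpha>"
        by (rule mult_right_mono) simp
      also have "\<dots> = (\<Sum>k\<in>{1..<n}. \<bar>x k\<bar>) / real n * real n powr \<alpha>
          + (1 - 1 / real n) * \<bar>x n\<bar> * real n powr \<alpha>"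
        by (simp add: distrib_right)
      also have "\<dots> \<le> M * weighted_past \<alpha> n + M"
        by (intro add_mono past_term_le present_term_le M n)
      also have "\<dots> \<le> M * (1 / (1 - \<alpha>)) + M"
        by (intro add_right_mono mult_left_mono weighted_past_le assms M n)
      also have "\<dots> = (2 - \<alpha>) / (1 - \<alpha>) * M"
        unfolding split_const by (simp add: distrib_right)
      finally show "\<bar>defect x n\<bar> * real n powr \<alpha> \<le> (2 - \<alpha>) / (1 - \<alpha>) * M" .
    qed (use assms in auto)
  next
    fix n k :: nat
    assume "1 \<le> n" "1 \<le> k"
    then show "\<bar>y n k\<bar> * real k powr \<alpha> \<le> 1"
      using truncated_power_normalised[of k \<alpha> n] by (auto simp: y_def powr_minus)
  next
    fix n :: nat
    assume n: "1 \<le> n"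
    have "(\<Sum>k\<in>{1..<n}. y n k) = (\<Sum>k\<in>{1..<n}. real k powr -\<alpha>)"
      by (rule sum.cong) (auto simp: y_def truncated_power_def)
    then have "defect (y n) n
        = (\<Sum>k\<in>{1..<n}. real k powr -\<alpha>) / real n + (1 - 1 / real n) * real n powr -\<alpha>"
      using n by (simp add: defect_split y_def)
    moreover have "\<dots> \<ge> 0"
      using n by (intro add_nonneg_nonneg mult_nonneg_nonneg divide_nonneg_nonneg sum_nonneg) auto
    ultimately have "\<bar>defect (y n) n\<bar> * real n powr \<alpha> = weighted_past \<alpha> n + (1 - 1 / real n)"
      using n by (simp add: weighted_past_def distrib_right powr_minus)
    then show "past_minorant \<alpha> n + (1 - 1 / real n) \<le> \<bar>defect (y n) n\<bar> * real n powr \<alpha>"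
      using past_minorant_le[OF assms n] by simp
  next
    have "(\<lambda>n. 1 - 1 / real n) \<longlonglongrightarrow> 1"
      by real_asymp
    then show "(\<lambda>n. ennreal (past_minorant \<alpha> n + (1 - 1 / real n)))
        \<longlonglongrightarrow> ennreal ((2 - \<alpha>) / (1 - \<alpha>))"
      unfolding split_const by (intro tendsto_ennrealI tendsto_add past_minorant_tendsto assms)
  qed auto
qed

lemma nonneg_ineq_holds:
  assumes "\<alpha> < 1" "x \<in> nonneg_seqs"
  shows "ineq_holds \<alpha> (ennreal (max 1 (1 / (1 - \<alpha>)))) x"
proof (rule ineq_holdsI)
  fix M :: real and n :: nat
  assume M: "0 \<le> M" "\<And>k. 1 \<le> k \<Longrightarrow> \<bar>x k\<bar> * real k powr \<alpha> \<le> M" and n: "1 \<le> n"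
  define past where "past = (\<Sum>k\<in>{1..<n}. \<bar>x k\<bar>) / real n"
  define present where "present = (1 - 1 / real n) * \<bar>x n\<bar>"
  have "(\<Sum>k\<in>{1..<n}. x k) = (\<Sum>k\<in>{1..<n}. \<bar>x k\<bar>)"
    by (rule sum.cong) (use assms(2) in \<open>auto simp: nonneg_seqs_def\<close>)
  then have "defect x n = past - present"
    using assms(2) n by (simp add: defect_split past_def present_def nonneg_seqs_def)
  moreover have "0 \<le> past" "0 \<le> present"
    using n by (auto simp: past_def present_def sum_nonneg)
  ultimately have "\<bar>defect x n\<bar> \<le> max past present"
    by linarith
  then have "\<bar>defect x n\<bar> * real n powr \<alpha> \<le> max past present * real n powr \<alpha>"
    by (rule mult_right_mono) simp
  also have "\<dots> = max (past * real n powr \<alpha>) (present * real n powr \<alpha>)"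
    by (simp add: max_mult_distrib_right)
  also have "\<dots> \<le> max (M * (1 / (1 - \<alpha>))) (M * 1)"
  proof (rule max.mono)
    have "past * real n powr \<alpha> \<le> M * weighted_past \<alpha> n"
      unfolding past_def by (rule past_term_le) (rule M)
    also have "\<dots> \<le> M * (1 / (1 - \<alpha>))"
      by (intro mult_left_mono weighted_past_le assms M n)
    finally show "past * real n powr \<alpha> \<le> M * (1 / (1 - \<alpha>))" .
    show "present * real n powr \<alpha> \<le> M * 1"
      unfolding present_def using present_term_le[of x n \<alpha> M, OF M(2)[OF n] n] by simp
  qed
  also have "\<dots> \<le> max 1 (1 / (1 - \<alpha>)) * M"
    unfolding mult.commute[of M] by (intro max.boundedI mult_right_mono M) auto
  finally show "\<bar>defect x n\<bar> * real n powr \<alpha> \<le> max 1 (1 / (1 - \<alpha>)) * M" .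
qed simp

lemma truncated_power_nonneg: "truncated_power \<alpha> n \<in> nonneg_seqs"
  by (simp add: nonneg_seqs_def truncated_power_def)

lemma truncated_power_nonincreasing:
  assumes "0 \<le> \<alpha>"
  shows "truncated_power \<alpha> n \<in> nonincreasing_seqs"
  using assms by (auto simp: nonincreasing_seqs_def truncated_power_def intro!: monotone_onI powr_mono2')

text \<open>
  This covers nonnegative sequences and, since \<open>k powr -\<alpha>\<close> does not increase, also the
  nonnegative, nonincreasing ones.
\<close>

lemma best_constant_between:
  assumes "0 \<le> \<alpha>" "\<alpha> < 1" "S \<subseteq> nonneg_seqs" "\<And>n. truncated_power \<alpha> n \<in> S"
  shows "best_constant \<alpha> S (ennreal (1 / (1 - \<alpha>)))"
proof (rule best_constantI[where y = "truncated_power \<alpha>" and c = "past_minorant \<alpha>"])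
  show "ineq_holds \<alpha> (ennreal (1 / (1 - \<alpha>))) x" if "x \<in> S" for x
  proof -
    have "max 1 (1 / (1 - \<alpha>)) = 1 / (1 - \<alpha>)"
      using assms by (simp add: max_def)
    then show ?thesis
      using nonneg_ineq_holds[of \<alpha> x] assms that by auto
  qed
  show "past_minorant \<alpha> n \<le> \<bar>defect (truncated_power \<alpha> n) n\<bar> * real n powr \<alpha>" if "1 \<le> n" for n
    using past_minorant_le[OF assms(2) that] defect_truncated_power[OF that] by simp
  show "(\<lambda>n. ennreal (past_minorant \<alpha> n)) \<longlonglongrightarrow> ennreal (1 / (1 - \<alpha>))"
    by (intro tendsto_ennrealI past_minorant_tendsto assms)
qed (use assms in \<open>auto intro: truncated_power_normalised\<close>)

lemma one_minus_inverse_tendsto: "(\<lambda>n. ennreal (1 - 1 / real n)) \<longlonglongrightarrow> 1"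
proof -
  have "(\<lambda>n. 1 - 1 / real n) \<longlonglongrightarrow> 1"
    by real_asymp
  from tendsto_ennrealI[OF this] show ?thesis
    by simp
qed

lemma defect_jump:
  assumes "1 \<le> n" "\<And>k. k < n \<Longrightarrow> x k = 0" "x n = real n powr -\<alpha>"
  shows "\<bar>defect x n\<bar> * real n powr \<alpha> = 1 - 1 / real n"
proof -
  have "defect x n = - ((1 - 1 / real n) * real n powr -\<alpha>)"
    using assms by (simp add: defect_split)
  then show ?thesis
    using assms(1) by (simp add: abs_mult powr_minus)
qed

lemma best_constant_nonneg_neg:
  assumes "\<alpha> < 0"
  shows "best_constant \<alpha> nonneg_seqs 1"
proof (rule best_constantI[where c = "\<lambda>n. 1 - 1 / real n"
      and y = "\<lambda>n k. if k = n then real n powr -\<alpha> else 0"])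
  show "ineq_holds \<alpha> 1 x" if "x \<in> nonneg_seqs" for x
  proof -
    have "max 1 (1 / (1 - \<alpha>)) = 1"
      using assms by (simp add: max_def)
    then show ?thesis
      using nonneg_ineq_holds[of \<alpha> x] assms that by auto
  qed
  show "1 - 1 / real n \<le> \<bar>defect (\<lambda>k. if k = n then real n powr -\<alpha> else 0) n\<bar> * real n powr \<alpha>"
    if "1 \<le> n" for n
    by (rule eq_refl, rule defect_jump[symmetric]) (use that in auto)
qed (auto simp: nonneg_seqs_def powr_minus one_minus_inverse_tendsto)


section \<open>Nonincreasing sequences\<close>

text \<open>
  The weighted defect at \<open>m + 1\<close> of the sequence that is \<open>1\<close> up to \<open>m\<close> and \<open>0\<close> afterwards.
\<close>

definition step_defect :: "real \<Rightarrow> nat \<Rightarrow> real" where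
  "step_defect \<alpha> m = real (m + 1) powr (\<alpha> - 1) * real m"

lemma step_defect_eq_exp:
  "1 \<le> m \<Longrightarrow> step_defect \<alpha> m = exp (ln (real m) + (\<alpha> - 1) * ln (real m + 1))"
  by (simp add: step_defect_def exp_add powr_def add.commute)

lemma log_step_defect_deriv:
  fixes u :: real
  assumes "0 < u"
  shows "((\<lambda>u. ln u + (\<alpha> - 1) * ln (u + 1)) has_real_derivative (\<alpha> * u + 1) / (u * (u + 1))) (at u)"
proof -
  have deriv: "(\<alpha> * u + 1) / (u * (u + 1)) = 1 / u + (\<alpha> - 1) * (1 / (u + 1))"
    using assms by (simp add: add_pos_pos add_frac_eq) (simp add: algebra_simps)
  show ?thesis
    unfolding deriv using assms by (auto intro!: derivative_eq_intros)
qed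

lemma step_defect_increasing:
  assumes "1 \<le> a" "a < b" "0 \<le> \<alpha> * real b + 1"
  shows "step_defect \<alpha> a < step_defect \<alpha> b"
proof -
  have "ln (real a) + (\<alpha> - 1) * ln (real a + 1) < ln (real b) + (\<alpha> - 1) * ln (real b + 1)"
  proof (rule DERIV_pos_imp_increasing_open[of _ _ "\<lambda>u. ln u + (\<alpha> - 1) * ln (u + 1)"])
    fix u assume u: "real a < u" "u < real b"
    have "0 < \<alpha> * u + 1"
    proof (cases "\<alpha> < 0")
      case True
      then have "\<alpha> * real b < \<alpha> * u"
        using u by simp
      then show ?thesis
        using assms(3) by linarith
    next
      case False
      then show ?thesis
        using u by (simp add: add_nonneg_pos)
    qed
    then have "0 < (\<alpha> * u + 1) / (u * (u + 1))"
      using u by (intro divide_pos_pos mult_pos_pos) auto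
    then show "\<exists>d. ((\<lambda>u. ln u + (\<alpha> - 1) * ln (u + 1)) has_real_derivative d) (at u) \<and> 0 < d"
      using log_step_defect_deriv[of u \<alpha>] u by force
  qed (use assms in \<open>auto intro!: continuous_intros\<close>)
  then show ?thesis
    using assms by (simp add: step_defect_eq_exp)
qed

lemma step_defect_decreasing:
  assumes "1 \<le> a" "a < b" "\<alpha> * real a + 1 \<le> 0"
  shows "step_defect \<alpha> b < step_defect \<alpha> a"
proof -
  have "\<alpha> < 0"
    using assms(1,3) by (smt (verit) mult_nonneg_nonneg of_nat_0_le_iff)
  have "ln (real b) + (\<alpha> - 1) * ln (real b + 1) < ln (real a) + (\<alpha> - 1) * ln (real a + 1)"
  proof (rule DERIV_neg_imp_decreasing_open[of _ _ "\<lambda>u. ln u + (\<alpha> - 1) * ln (u + 1)"])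
    fix u assume u: "real a < u" "u < real b"
    then have "\<alpha> * u < \<alpha> * real a"
      using \<open>\<alpha> < 0\<close> by simp
    then have "(\<alpha> * u + 1) / (u * (u + 1)) < 0"
      using u assms(3) by (intro divide_neg_pos mult_pos_pos) auto
    then show "\<exists>d. ((\<lambda>u. ln u + (\<alpha> - 1) * ln (u + 1)) has_real_derivative d) (at u) \<and> d < 0"
      using log_step_defect_deriv[of u \<alpha>] u by force
  qed (use assms in \<open>auto intro!: continuous_intros\<close>)
  then show ?thesis
    using assms by (simp add: step_defect_eq_exp)
qed

text \<open>
  A decrease just after \<open>m\<close> means that \<open>m + 1\<close> lies beyond the turning point \<open>-1/\<alpha>\<close>, an increase
  just before \<open>m\<close> that \<open>m - 1\<close> lies short of it. Hence the terms keep decreasing to the right of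
  \<open>m + 1\<close> and increase up to \<open>m - 1\<close>.
\<close>

lemma step_defect_le_peak:
  assumes "1 \<le> m" "m = 1 \<or> step_defect \<alpha> (m - 1) < step_defect \<alpha> m"
    and "step_defect \<alpha> (m + 1) \<le> step_defect \<alpha> m" "1 \<le> j"
  shows "step_defect \<alpha> j \<le> step_defect \<alpha> m"
proof (cases j m rule: linorder_cases)
  case less
  then have m: "step_defect \<alpha> (m - 1) < step_defect \<alpha> m" "1 \<le> m - 1"
    using assms by auto
  then have "0 \<le> \<alpha> * real (m - 1) + 1"
    using step_defect_decreasing[of "m - 1" m \<alpha>] by force
  moreover have "j = m - 1 \<or> j < m - 1"
    using less by linarith
  ultimately have "step_defect \<alpha> j \<le> step_defect \<alpha> (m - 1)"
    using step_defect_increasing[of j "m - 1" \<alpha>] assms(4) by fastforce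
  then show ?thesis
    using m by simp
next
  case greater
  have "\<alpha> * real (m + 1) + 1 \<le> 0"
    using step_defect_increasing[of m "m + 1" \<alpha>] assms(1,3) by force
  then have "step_defect \<alpha> j \<le> step_defect \<alpha> (m + 1)"
    using step_defect_decreasing[of "m + 1" j \<alpha>] greater by (cases "j = m + 1") auto
  then show ?thesis
    using assms(3) by simp
qed simp

text \<open>
  Taking logarithms, both sides say \<open>ln (1 - 1/m) < (\<alpha> - 1) * ln (1 + 1/m)\<close>.
\<close>

lemma s_less_iff:
  assumes "2 \<le> m"
  shows "s m < ereal \<alpha> \<longleftrightarrow> step_defect \<alpha> (m - 1) < step_defect \<alpha> m"
proof -
  have minus: "ln (1 - 1 / real m) = ln (real m - 1) - ln (real m)"
  proof -
    have "1 - 1 / real m = (real m - 1) / real m"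
      using assms by (simp add: diff_divide_distrib)
    then show ?thesis
      using assms by (simp add: ln_div)
  qed
  have plus: "ln (1 + 1 / real m) = ln (real m + 1) - ln (real m)"
  proof -
    have "1 + 1 / real m = (real m + 1) / real m"
      using assms by (simp add: add_divide_distrib)
    then show ?thesis
      using assms by (simp add: ln_div)
  qed
  have "0 < ln (1 + 1 / real m)"
    using assms by (intro ln_gt_zero) auto
  have "s m < ereal \<alpha> \<longleftrightarrow> ln (1 - 1 / real m) / ln (1 + 1 / real m) < \<alpha> - 1"
    using assms by (auto simp: s_def)
  also have "\<dots> \<longleftrightarrow> ln (1 - 1 / real m) < (\<alpha> - 1) * ln (1 + 1 / real m)"
    using \<open>0 < ln (1 + 1 / real m)\<close> by (rule pos_divide_less_eq)
  also have "\<dots> \<longleftrightarrow> ln (real m - 1) + (\<alpha> - 1) * ln (real m)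
                    < ln (real m) + (\<alpha> - 1) * ln (real m + 1)"
    unfolding minus plus by (simp add: algebra_simps)
  also have "\<dots> \<longleftrightarrow> step_defect \<alpha> (m - 1) < step_defect \<alpha> m"
    using assms by (simp add: step_defect_eq_exp of_nat_diff)
  finally show ?thesis .
qed

lemma s_interval_iff:
  assumes "1 \<le> m"
  shows "s m < ereal \<alpha> \<and> ereal \<alpha> \<le> s (m + 1) \<longleftrightarrow>
      (m = 1 \<or> step_defect \<alpha> (m - 1) < step_defect \<alpha> m) \<and> step_defect \<alpha> (m + 1) \<le> step_defect \<alpha> m"
proof -
  have "s m < ereal \<alpha> \<longleftrightarrow> m = 1 \<or> step_defect \<alpha> (m - 1) < step_defect \<alpha> m"
    using assms s_less_iff[of m \<alpha>] by (cases "m = 1") (auto simp: s_def)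
  moreover have "ereal \<alpha> \<le> s (m + 1) \<longleftrightarrow> step_defect \<alpha> (m + 1) \<le> step_defect \<alpha> m"
    using assms s_less_iff[of "m + 1" \<alpha>] by (auto simp: not_less[symmetric])
  ultimately show ?thesis
    by simp
qed

lemma s_interval_exists:
  assumes "\<alpha> < 0"
  shows "\<exists>m\<ge>1. s m < ereal \<alpha> \<and> ereal \<alpha> \<le> s (m + 1)"
proof -
  \<comment> \<open>The first index followed by a decrease; past \<open>-1/\<alpha>\<close> every index is.\<close>
  define P where "P m \<longleftrightarrow> 1 \<le> m \<and> step_defect \<alpha> (m + 1) \<le> step_defect \<alpha> m" for m
  obtain N :: nat where N: "-1 / \<alpha> < real N"
    using reals_Archimedean2 by blast
  have "0 < -1 / \<alpha>"
    using assms by (simp add: divide_neg_neg)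
  then have "0 < N"
    using N by (metis less_trans of_nat_0_less_iff)
  moreover have "\<alpha> * real N + 1 \<le> 0"
    using N assms by (simp add: field_simps)
  ultimately have "P N"
    using step_defect_decreasing[of N "N + 1" \<alpha>] by (simp add: P_def)
  define m where "m = (LEAST m. P m)"
  have "P m"
    unfolding m_def using \<open>P N\<close> by (rule LeastI)
  moreover have "m = 1 \<or> step_defect \<alpha> (m - 1) < step_defect \<alpha> m"
  proof (cases "m = 1")
    case False
    then have "\<not> P (m - 1)"
      using \<open>P m\<close> not_less_Least[of "m - 1" P] by (simp add: P_def m_def)
    then show ?thesis
      using \<open>P m\<close> False by (auto simp: P_def not_le)
  qed simp
  ultimately show ?thesis
    using s_interval_iff[of m \<alpha>] by (auto simp: P_def)
qed

lemma best_constant_nonincreasing_neg: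
  assumes "1 \<le> m" "s m < ereal \<alpha>" "ereal \<alpha> \<le> s (m + 1)"
  shows "best_constant \<alpha> (nonneg_seqs \<inter> nonincreasing_seqs) (ennreal (step_defect \<alpha> m))"
proof -
  have peak: "m = 1 \<or> step_defect \<alpha> (m - 1) < step_defect \<alpha> m"
    "step_defect \<alpha> (m + 1) \<le> step_defect \<alpha> m"
    using assms s_interval_iff[of m \<alpha>] by blast+
  have "\<alpha> * real (m + 1) + 1 < 0"
    using step_defect_increasing[of m "m + 1" \<alpha>] assms(1) peak(2) by force
  then have neg: "\<alpha> < 0"
    by (smt (verit) mult_nonneg_nonneg of_nat_0_le_iff)
  \<comment> \<open>The step at \<open>m\<close> is itself extremal, so one test sequence suffices for optimality.\<close>
  define y :: "nat \<Rightarrow> real" where "y k = (if k \<le> m then 1 else 0)" for k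
  show ?thesis
    unfolding best_constant_def
  proof (intro conjI ballI allI impI)
    fix x assume x: "x \<in> nonneg_seqs \<inter> nonincreasing_seqs"
    then have mono: "x l \<le> x k" if "1 \<le> k" "k \<le> l" for k l
      using that monotone_onD[of "{1..}" "(\<le>)" "(\<ge>)" x k l]
      by (simp add: nonincreasing_seqs_def)
    show "ineq_holds \<alpha> (ennreal (step_defect \<alpha> m)) x"
    proof (rule ineq_holdsI)
      fix M :: real and n :: nat
      assume M: "0 \<le> M" "\<And>k. 1 \<le> k \<Longrightarrow> \<bar>x k\<bar> * real k powr \<alpha> \<le> M" and n: "1 \<le> n"
      have "x 1 \<le> M"
        using M(2)[of 1] by simp
      have pos: "0 \<le> x n"
        using x n by (simp add: nonneg_seqs_def)
      have upper: "(\<Sum>k\<in>{1..<n}. x k) \<le> (\<Sum>k\<in>{1..<n}. M)"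
        using mono[of 1] \<open>x 1 \<le> M\<close> by (intro sum_mono) force
      have lower: "(\<Sum>k\<in>{1..<n}. x n) \<le> (\<Sum>k\<in>{1..<n}. x k)"
        using mono by (intro sum_mono) auto
      have "0 \<le> defect x n"
        using lower n by (simp add: defect_split field_simps of_nat_diff)
      moreover have "defect x n \<le> real (n - 1) * M / real n"
      proof -
        have "defect x n \<le> (\<Sum>k\<in>{1..<n}. x k) / real n"
          using pos n by (simp add: defect_split)
        also have "\<dots> \<le> real (n - 1) * M / real n"
          using upper by (intro divide_right_mono) auto
        finally show ?thesis .
      qed
      ultimately have "\<bar>defect x n\<bar> * real n powr \<alpha> \<le> real (n - 1) * M / real n * real n powr \<alpha>"
        by (intro mult_right_mono) auto
      also have "\<dots> = step_defect \<alpha> (n - 1) * M"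
        using n by (simp add: step_defect_def powr_diff)
      also have "\<dots> \<le> step_defect \<alpha> m * M"
      proof (cases "n = 1")
        case True
        then show ?thesis
          using M(1) by (simp add: step_defect_def)
      next
        case False
        then show ?thesis
          using n M(1) by (intro mult_right_mono step_defect_le_peak[OF assms(1) peak]) auto
      qed
      finally show "\<bar>defect x n\<bar> * real n powr \<alpha> \<le> step_defect \<alpha> m * M" .
    qed (simp add: step_defect_def)
  next
    fix B assume B: "\<forall>x\<in>nonneg_seqs \<inter> nonincreasing_seqs. ineq_holds \<alpha> B x"
    have "y \<in> nonneg_seqs \<inter> nonincreasing_seqs"
      by (auto simp: y_def nonneg_seqs_def nonincreasing_seqs_def intro!: monotone_onI)
    moreover have "\<bar>y k\<bar> * real k powr \<alpha> \<le> 1" if "1 \<le> k" for k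
      using that neg powr_mono[of \<alpha> 0 "real k"] by (simp add: y_def)
    ultimately have "ennreal (\<bar>defect y (m + 1)\<bar> * real (m + 1) powr \<alpha>) \<le> B"
      using B by (intro defect_le_constant) auto
    moreover have "\<bar>defect y (m + 1)\<bar> * real (m + 1) powr \<alpha> = step_defect \<alpha> m"
    proof -
      have "(\<Sum>k\<in>{1..<m + 1}. y k) = (\<Sum>k\<in>{1..<m + 1}. 1)"
        by (rule sum.cong) (auto simp: y_def)
      then have "defect y (m + 1) = real m / real (m + 1)"
        by (simp add: defect_split y_def)
      then show ?thesis
        by (simp add: step_defect_def powr_diff)
    qed
    ultimately show "ennreal (step_defect \<alpha> m) \<le> B"
      by simp
  qed
qed


section \<open>Nondecreasing sequences\<close>

lemma nondecreasing_seqsD: "\<lbrakk>x \<in> nondecreasing_seqs; 1 \<le> k; k \<le> l\<rbrakk> \<Longrightarrow> x k \<le> x l"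
  using monotone_onD[of "{1..}" "(\<le>)" "(\<le>)" x k l] by (simp add: nondecreasing_seqs_def)

lemma nondecreasing_ineq_holds:
  assumes "x \<in> nonneg_seqs \<inter> nondecreasing_seqs"
  shows "ineq_holds \<alpha> 1 x"
proof -
  have "ineq_holds \<alpha> (ennreal 1) x"
  proof (rule ineq_holdsI)
    fix M :: real and n :: nat
    assume M: "0 \<le> M" "\<And>k. 1 \<le> k \<Longrightarrow> \<bar>x k\<bar> * real k powr \<alpha> \<le> M" and n: "1 \<le> n"
    have pos: "0 \<le> x k" if "1 \<le> k" for k
      using assms that by (simp add: nonneg_seqs_def)
    have "(\<Sum>k\<in>{1..<n}. x k) \<le> (\<Sum>k\<in>{1..<n}. x n)"
      using assms by (intro sum_mono) (auto intro: nondecreasing_seqsD)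
    then have "defect x n \<le> 0"
      using n by (simp add: defect_split field_simps of_nat_diff)
    moreover have "0 \<le> (\<Sum>k\<in>{1..<n}. x k) / real n"
      by (intro divide_nonneg_nonneg sum_nonneg) (auto intro: pos)
    ultimately have "\<bar>defect x n\<bar> \<le> (1 - 1 / real n) * \<bar>x n\<bar>"
      using defect_split[OF n, of x] pos[OF n] by simp
    then have "\<bar>defect x n\<bar> * real n powr \<alpha> \<le> (1 - 1 / real n) * \<bar>x n\<bar> * real n powr \<alpha>"
      by (rule mult_right_mono) simp
    also have "\<dots> \<le> M"
      by (intro present_term_le M n)
    finally show "\<bar>defect x n\<bar> * real n powr \<alpha> \<le> 1 * M"
      by simp
  qed simp
  then show ?thesis
    by simp
qed

lemma best_constant_nondecreasing_nonpos:
  assumes "\<alpha> \<le> 0"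
  shows "best_constant \<alpha> (nonneg_seqs \<inter> nondecreasing_seqs) 1"
proof (rule best_constantI[where c = "\<lambda>n. 1 - 1 / real n"
      and y = "\<lambda>n k. if n \<le> k then real n powr -\<alpha> else 0"])
  fix n k :: nat
  assume "1 \<le> n" "1 \<le> k"
  then show "\<bar>if n \<le> k then real n powr -\<alpha> else 0\<bar> * real k powr \<alpha> \<le> 1"
    using assms powr_mono2'[of \<alpha> "real n" "real k"] by (simp add: powr_minus field_simps)
next
  fix n :: nat
  assume "1 \<le> n"
  then show "1 - 1 / real n
      \<le> \<bar>defect (\<lambda>k. if n \<le> k then real n powr -\<alpha> else 0) n\<bar> * real n powr \<alpha>"
    by (subst defect_jump) auto
qed (auto simp: nonneg_seqs_def nondecreasing_seqs_def
    intro!: monotone_onI nondecreasing_ineq_holds one_minus_inverse_tendsto)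

text \<open>
  If some term \<open>x j\<close> is positive, then \<open>x k * k\<^sup>\<alpha> \<ge> x j * k\<^sup>\<alpha>\<close> for \<open>k \<ge> j\<close> is unbounded; so
  the inequality only has content for the zero sequence.
\<close>

lemma best_constant_nondecreasing_pos:
  assumes "0 < \<alpha>"
  shows "best_constant \<alpha> (nonneg_seqs \<inter> nondecreasing_seqs) 0"
proof -
  have "ineq_holds \<alpha> (ennreal 0) x" if x: "x \<in> nonneg_seqs \<inter> nondecreasing_seqs" for x
  proof (rule ineq_holdsI)
    fix M :: real and n :: nat
    assume M: "\<And>k. 1 \<le> k \<Longrightarrow> \<bar>x k\<bar> * real k powr \<alpha> \<le> M"
    have zero: "x j = 0" if j: "1 \<le> j" for j
    proof (rule ccontr)
      assume "x j \<noteq> 0"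
      then have "0 < x j"
        using x j by (simp add: nonneg_seqs_def less_le)
      have "x j * real k powr \<alpha> \<le> M" if "j \<le> k" for k
      proof -
        have "x j \<le> x k"
          using x j that by (auto intro: nondecreasing_seqsD)
        then have "x j * real k powr \<alpha> \<le> \<bar>x k\<bar> * real k powr \<alpha>"
          by (intro mult_right_mono) auto
        also have "\<dots> \<le> M"
          using M j that by simp
        finally show ?thesis .
      qed
      moreover have "filterlim (\<lambda>k. x j * real k powr \<alpha>) at_top sequentially"
        using \<open>0 < x j\<close> assms by real_asymp
      then have "\<forall>\<^sub>F k in sequentially. M < x j * real k powr \<alpha>"
        by (simp add: filterlim_at_top_dense)
      then obtain N where "\<And>k. N \<le> k \<Longrightarrow> M < x j * real k powr \<alpha>"
        by (auto simp: eventually_sequentially)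
      ultimately show False
        by (meson max.cobounded1 max.cobounded2 not_le)
    qed
    assume "1 \<le> n"
    then show "\<bar>defect x n\<bar> * real n powr \<alpha> \<le> 0 * M"
      by (simp add: defect_def zero)
  qed simp
  then show ?thesis
    by (simp add: best_constant_def)
qed


section \<open>The four classes of sequences\<close>

theorem theorem3p9:
  fixes \<alpha> :: real
  shows
    "best_constant \<alpha> UNIV (if \<alpha> < 1 then ennreal ((2 - \<alpha>) / (1 - \<alpha>)) else \<infinity>)
   \<and> best_constant \<alpha> nonneg_seqs
       (if \<alpha> < 0 then 1 else if \<alpha> < 1 then ennreal (1 / (1 - \<alpha>)) else \<infinity>)
   \<and> ((\<forall>m::nat. 1 \<le> m \<and> s m < ereal \<alpha> \<and> ereal \<alpha> \<le> s (m + 1) \<longrightarrow>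
          best_constant \<alpha> (nonneg_seqs \<inter> nonincreasing_seqs)
            (ennreal (real (m + 1) powr (\<alpha> - 1) * real m)))
      \<and> (0 \<le> \<alpha> \<and> \<alpha> < 1 \<longrightarrow>
          best_constant \<alpha> (nonneg_seqs \<inter> nonincreasing_seqs) (ennreal (1 / (1 - \<alpha>))))
      \<and> (1 \<le> \<alpha> \<longrightarrow> best_constant \<alpha> (nonneg_seqs \<inter> nonincreasing_seqs) \<infinity>)
      \<and> (\<alpha> < 0 \<longrightarrow> (\<exists>m::nat. 1 \<le> m \<and> s m < ereal \<alpha> \<and> ereal \<alpha> \<le> s (m + 1))))
   \<and> best_constant \<alpha> (nonneg_seqs \<inter> nondecreasing_seqs) (if \<alpha> \<le> 0 then 1 else 0)"
proof (intro conjI allI impI)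
  show "best_constant \<alpha> UNIV (if \<alpha> < 1 then ennreal ((2 - \<alpha>) / (1 - \<alpha>)) else \<infinity>)"
    using best_constant_all best_constant_infinity[of \<alpha> UNIV] by auto
  show "best_constant \<alpha> nonneg_seqs
      (if \<alpha> < 0 then 1 else if \<alpha> < 1 then ennreal (1 / (1 - \<alpha>)) else \<infinity>)"
    using best_constant_nonneg_neg best_constant_between[of \<alpha> nonneg_seqs]
      best_constant_infinity[of \<alpha> nonneg_seqs] truncated_power_nonneg by auto
  show "best_constant \<alpha> (nonneg_seqs \<inter> nonincreasing_seqs)
      (ennreal (real (m + 1) powr (\<alpha> - 1) * real m))"
    if "1 \<le> m \<and> s m < ereal \<alpha> \<and> ereal \<alpha> \<le> s (m + 1)" for m
    using best_constant_nonincreasing_neg[of m \<alpha>] that by (simp add: step_defect_def)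
  show "best_constant \<alpha> (nonneg_seqs \<inter> nonincreasing_seqs) (ennreal (1 / (1 - \<alpha>)))"
    if "0 \<le> \<alpha> \<and> \<alpha> < 1"
    using that truncated_power_nonneg truncated_power_nonincreasing
    by (intro best_constant_between) auto
  show "best_constant \<alpha> (nonneg_seqs \<inter> nonincreasing_seqs) \<infinity>" if "1 \<le> \<alpha>"
    using that truncated_power_nonneg truncated_power_nonincreasing
    by (intro best_constant_infinity) auto
  show "\<exists>m. 1 \<le> m \<and> s m < ereal \<alpha> \<and> ereal \<alpha> \<le> s (m + 1)" if "\<alpha> < 0"
    using s_interval_exists[OF that] by blast
  show "best_constant \<alpha> (nonneg_seqs \<inter> nondecreasing_seqs) (if \<alpha> \<le> 0 then 1 else 0)"
    using best_constant_nondecreasing_nonpos best_constant_nondecreasing_pos by auto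
qed

end
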